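(* Let $(G,P)$ be a left-ordered group and let $z\in P$ be a central element of $G$ with $z>1$. Let $I=[1,z]=\{g\in G: 1\le g\le z\}$, and let $p_I$ be the associated point of the topos $\hat\Delta$ of simplicial sets. Then the formula $$\tau_n(\beta)_j:=\beta_1^{-1}\beta_{j+1}\quad (0\le j\le n),\qquad \tau_n(\beta)_{n+1}:=z,\qquad \beta\in\mathcal F_I([n]),\ n\ge 0,$$ defines a cyclic structure on $p_I$.
   Context: A left order on a group $G$ is a subsemigroup $P\subset G$ ($PP\subseteq P$) with $P\cap P^{-1}=\{1\}$ and $P\cup P^{-1}=G$; the associated total order is $a\le b\iff a^{-1}b\in P$ (it is invariant under left translations). $\Delta$ is the simplicial category: objects $[n]=\{0,\dots,n\}$, $n\ge0$, morphisms the non-decreasing maps. The cyclic category $\Lambda$ has one object $[n]$ for each $n\ge 0$, and $\mathrm{Hom}_\Lambda([n],[m])$ is the set of non-decreasing maps $f:\mathbb Z\to\mathbb Z$ with $f(x+n+1)=f(x)+m+1$ for all $x$, modulo $f\sim f+k(m+1)$, $k\in\mathbb Z$; composition is composition of maps. $\tau_n\in\mathrm{Aut}_\Lambda([n])$ is the class of $x\mapsto x-1$; it generates $\mathrm{Aut}_\Lambda([n])\cong\mathbb Z/(n+1)\mathbb Z$. The inclusion $j:\Delta\hookrightarrow\Lambda$ is the identity on objects and $j(f)(x+k(n+1))=f(x)+k(m+1)$ for $f\in\mathrm{Hom}_\Delta([n],[m])$, $x\in[n]$, $k\in\mathbb Z$. For a totally ordered set $I$ with smallest element $b$ and largest element $t$,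 $b<t$ (here $b=1$, $t=z$), the point $p_I$ of $\hat\Delta=\mathrm{Sets}^{\Delta^{\rm op}}$ is given by the flat covariant functor $\mathcal F_I:\Delta\to\mathrm{Sets}$, where $\mathcal F_I([n])$ is the set of non-decreasing sequences $\beta=(\beta_j)_{0\le j\le n+1}$ in $I$ with $\beta_0=b$, $\beta_{n+1}=t$, and for $f\in\mathrm{Hom}_\Delta([n],[m])$, $(f_*\beta)_j=\beta_{f^*(j)}$ with $f^*(j)=\min\{i\in[n]: f(i)\ge j\}$ (and $f^*(j)=n+1$ if there is no such $i$), $0\le j\le m+1$. A cyclic structure on $p_I$ is an extension of $\mathcal F_I$ to a functor $\tilde{\mathcal F}:\Lambda\to\mathrm{Sets}$ with $\tilde{\mathcal F}\circ j=\mathcal F_I$. "The formula defines a cyclic structure" means that there is a (necessarily unique) such extension for which $\tilde{\mathcal F}(\tau_n)$ is given by the displayed formula for all $n\ge0$. *)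

theory Defs
  imports "HOL-Algebra.Coset" "HOL-Library.FuncSet"
begin

section \<open>Small categories and set-valued functors\<close>

text \<open>Every element of the type \<open>'o\<close> is an object; \<open>cat_comp C x y z g f\<close> is
  \<open>g\<close> after \<open>f\<close> for \<open>f : x \<rightarrow> y\<close> and \<open>g : y \<rightarrow> z\<close>.\<close>

record ('o, 'm) category =
  cat_hom :: "'o \<Rightarrow> 'o \<Rightarrow> 'm set"
  cat_id :: "'o \<Rightarrow> 'm"
  cat_comp :: "'o \<Rightarrow> 'o \<Rightarrow> 'o \<Rightarrow> 'm \<Rightarrow> 'm \<Rightarrow> 'm"

definition is_category :: "('o, 'm) category \<Rightarrow> bool" where
  "is_category C \<longleftrightarrow>
    (\<forall>x. cat_id C x \<in> cat_hom C x x) \<and>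
    (\<forall>x y z. \<forall>f\<in>cat_hom C x y. \<forall>g\<in>cat_hom C y z. cat_comp C x y z g f \<in> cat_hom C x z) \<and>
    (\<forall>x y. \<forall>f\<in>cat_hom C x y. cat_comp C x x y f (cat_id C x) = f
                            \<and> cat_comp C x y y (cat_id C y) f = f) \<and>
    (\<forall>w x y z. \<forall>f\<in>cat_hom C w x. \<forall>g\<in>cat_hom C x y. \<forall>h\<in>cat_hom C y z.
       cat_comp C w x z (cat_comp C x y z h g) f = cat_comp C w y z h (cat_comp C w x y g f))"

record ('o, 'm, 'x) set_diagram =
  on_obj :: "'o \<Rightarrow> 'x set"
  on_arr :: "'o \<Rightarrow> 'o \<Rightarrow> 'm \<Rightarrow> 'x \<Rightarrow> 'x"

text \<open>Both the action on arrows and the resulting maps are extensional, so that functors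
  which agree as mathematical objects are equal in HOL.\<close>

definition set_functor :: "('o, 'm) category \<Rightarrow> ('o, 'm, 'x) set_diagram \<Rightarrow> bool" where
  "set_functor C T \<longleftrightarrow>
    (\<forall>x y. on_arr T x y \<in> cat_hom C x y \<rightarrow>\<^sub>E (on_obj T x \<rightarrow>\<^sub>E on_obj T y)) \<and>
    (\<forall>x. on_arr T x x (cat_id C x) = (\<lambda>u\<in>on_obj T x. u)) \<and>
    (\<forall>x y z. \<forall>f\<in>cat_hom C x y. \<forall>g\<in>cat_hom C y z.
       on_arr T x z (cat_comp C x y z g f)
         = compose (on_obj T x) (on_arr T y z g) (on_arr T x y f))"

text \<open>Restriction along an identity-on-objects functor with source \<open>C\<close> and arrow map \<open>J\<close>.\<close>

definition restrict_along ::
    "('o, 'm) category \<Rightarrow> ('o \<Rightarrow> 'o \<Rightarrow> 'm \<Rightarrow> 'k) \<Rightarrow> ('o, 'k, 'x) set_diagram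
       \<Rightarrow> ('o, 'm, 'x) set_diagram" where
  "restrict_along C J T =
    \<lparr>on_obj = on_obj T, on_arr = (\<lambda>x y. \<lambda>f\<in>cat_hom C x y. on_arr T x y (J x y f))\<rparr>"


section \<open>The simplicial and the cyclic category\<close>

text \<open>In both categories the natural number \<open>n\<close> stands for the object \<open>[n]\<close>.\<close>

definition simplex_cat :: "(nat, nat \<Rightarrow> nat) category" where
  "simplex_cat =
    \<lparr>cat_hom = (\<lambda>n m. {f \<in> {0..n} \<rightarrow>\<^sub>E {0..m}. mono_on {0..n} f}),
     cat_id = (\<lambda>n. \<lambda>i\<in>{0..n}. i),
     cat_comp = (\<lambda>n m l g f. compose {0..n} g f)\<rparr>"

definition cyclic_maps :: "nat \<Rightarrow> nat \<Rightarrow> (int \<Rightarrow> int) set" where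
  "cyclic_maps n m = {f. mono f \<and> (\<forall>x. f (x + int n + 1) = f x + int m + 1)}"

definition cyclic_rel :: "nat \<Rightarrow> nat \<Rightarrow> ((int \<Rightarrow> int) \<times> (int \<Rightarrow> int)) set" where
  "cyclic_rel n m = {(f, g). f \<in> cyclic_maps n m \<and> g \<in> cyclic_maps n m
      \<and> (\<exists>k::int. g = (\<lambda>x. f x + k * (int m + 1)))}"

definition cyclic_class :: "nat \<Rightarrow> nat \<Rightarrow> (int \<Rightarrow> int) \<Rightarrow> (int \<Rightarrow> int) set" where
  "cyclic_class n m f = cyclic_rel n m `` {f}"

text \<open>The set of all composites of representatives is itself the class of any one of them
  (lemma \<open>cyclic_comp_class\<close> below).\<close>

definition cyclic_cat :: "(nat, (int \<Rightarrow> int) set) category" where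
  "cyclic_cat =
    \<lparr>cat_hom = (\<lambda>n m. cyclic_maps n m // cyclic_rel n m),
     cat_id = (\<lambda>n. cyclic_class n n (\<lambda>x. x)),
     cat_comp = (\<lambda>n m l \<psi> \<phi>. {g \<circ> f |g f. g \<in> \<psi> \<and> f \<in> \<phi>})\<rparr>"

definition tau :: "nat \<Rightarrow> (int \<Rightarrow> int) set" where
  "tau n = cyclic_class n n (\<lambda>x. x - 1)"

text \<open>An integer \<open>y\<close> is uniquely \<open>x + k (n + 1)\<close> with \<open>x \<in> [n]\<close>, namely for
  \<open>x = y mod (n + 1)\<close> and \<open>k = y div (n + 1)\<close>.\<close>

definition simplex_lift :: "nat \<Rightarrow> nat \<Rightarrow> (nat \<Rightarrow> nat) \<Rightarrow> int \<Rightarrow> int" where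
  "simplex_lift n m f =
    (\<lambda>y. int (f (nat (y mod (int n + 1)))) + (y div (int n + 1)) * (int m + 1))"

definition simplex_to_cyclic :: "nat \<Rightarrow> nat \<Rightarrow> (nat \<Rightarrow> nat) \<Rightarrow> (int \<Rightarrow> int) set" where
  "simplex_to_cyclic n m f = cyclic_class n m (simplex_lift n m f)"


section \<open>The point of an ordered set with end points, and cyclic structures on it\<close>

definition dual_map :: "nat \<Rightarrow> (nat \<Rightarrow> nat) \<Rightarrow> nat \<Rightarrow> nat" where
  "dual_map n f j =
    (if \<exists>i\<in>{0..n}. j \<le> f i then Min {i \<in> {0..n}. j \<le> f i} else n + 1)"

definition interval_seqs ::
    "'a set \<Rightarrow> ('a \<Rightarrow> 'a \<Rightarrow> bool) \<Rightarrow> 'a \<Rightarrow> 'a \<Rightarrow> nat \<Rightarrow> (nat \<Rightarrow> 'a) set" where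
  "interval_seqs I leq b t n =
    {\<beta> \<in> {0..n+1} \<rightarrow>\<^sub>E I. monotone_on {0..n+1} (\<le>) leq \<beta> \<and> \<beta> 0 = b \<and> \<beta> (n+1) = t}"

definition interval_point ::
    "'a set \<Rightarrow> ('a \<Rightarrow> 'a \<Rightarrow> bool) \<Rightarrow> 'a \<Rightarrow> 'a \<Rightarrow> (nat, nat \<Rightarrow> nat, nat \<Rightarrow> 'a) set_diagram" where
  "interval_point I leq b t =
    \<lparr>on_obj = interval_seqs I leq b t,
     on_arr = (\<lambda>n m. \<lambda>f\<in>cat_hom simplex_cat n m. \<lambda>\<beta>\<in>interval_seqs I leq b t n.
                 \<lambda>j\<in>{0..m+1}. \<beta> (dual_map n f j))\<rparr>"

definition cyclic_structure ::
    "'a set \<Rightarrow> ('a \<Rightarrow> 'a \<Rightarrow> bool) \<Rightarrow> 'a \<Rightarrow> 'a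
       \<Rightarrow> (nat, (int \<Rightarrow> int) set, nat \<Rightarrow> 'a) set_diagram \<Rightarrow> bool" where
  "cyclic_structure I leq b t T \<longleftrightarrow>
    set_functor cyclic_cat T \<and>
    restrict_along simplex_cat simplex_to_cyclic T = interval_point I leq b t"


section \<open>Left-ordered groups\<close>

definition left_order :: "('a, 'b) monoid_scheme \<Rightarrow> 'a set \<Rightarrow> bool" where
  "left_order G P \<longleftrightarrow> P \<subseteq> carrier G \<and> P <#>\<^bsub>G\<^esub> P \<subseteq> P \<and>
     P \<inter> set_inv\<^bsub>G\<^esub> P = {\<one>\<^bsub>G\<^esub>} \<and> P \<union> set_inv\<^bsub>G\<^esub> P = carrier G"

definition lo_le :: "('a, 'b) monoid_scheme \<Rightarrow> 'a set \<Rightarrow> 'a \<Rightarrow> 'a \<Rightarrow> bool" where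
  "lo_le G P a b \<longleftrightarrow> inv\<^bsub>G\<^esub> a \<otimes>\<^bsub>G\<^esub> b \<in> P"

definition lo_less :: "('a, 'b) monoid_scheme \<Rightarrow> 'a set \<Rightarrow> 'a \<Rightarrow> 'a \<Rightarrow> bool" where
  "lo_less G P a b \<longleftrightarrow> lo_le G P a b \<and> a \<noteq> b"

definition lo_interval :: "('a, 'b) monoid_scheme \<Rightarrow> 'a set \<Rightarrow> 'a \<Rightarrow> 'a \<Rightarrow> 'a set" where
  "lo_interval G P a b = {g \<in> carrier G. lo_le G P a g \<and> lo_le G P g b}"


section \<open>The definitions are coherent\<close>

lemma cyclic_maps_shift:
  assumes "f \<in> cyclic_maps n m"
  shows "f (x + k * (int n + 1)) = f x + k * (int m + 1)"
proof -
  have 1: "f (x + int n + 1) = f x + int m + 1" for x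
    using assms by (auto simp: cyclic_maps_def)
  have pos: "f (x + int k * (int n + 1)) = f x + int k * (int m + 1)" for x k
  proof (induction k)
    case (Suc k)
    have "f (x + int (Suc k) * (int n + 1)) = f ((x + int k * (int n + 1)) + int n + 1)"
      by (simp add: algebra_simps)
    also have "\<dots> = f x + int (Suc k) * (int m + 1)"
      unfolding 1 Suc by (simp add: algebra_simps)
    finally show ?case .
  qed simp
  show ?thesis
  proof (cases "k \<ge> 0")
    case True
    then show ?thesis using pos[of x "nat k"] by simp
  next
    case False
    then show ?thesis using pos[of "x + k * (int n + 1)" "nat (- k)"] by simp
  qed
qed

lemma cyclic_maps_translate:
  "f \<in> cyclic_maps n m \<Longrightarrow> (\<lambda>x. f x + c) \<in> cyclic_maps n m"
  by (auto simp: cyclic_maps_def mono_def)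

lemma cyclic_maps_comp:
  "f \<in> cyclic_maps n m \<Longrightarrow> g \<in> cyclic_maps m l \<Longrightarrow> g \<circ> f \<in> cyclic_maps n l"
  by (auto simp: cyclic_maps_def mono_def)

lemma cyclic_maps_id: "(\<lambda>x. x) \<in> cyclic_maps n n"
  by (auto simp: cyclic_maps_def mono_def)

lemma cyclic_class_eq:
  "f \<in> cyclic_maps n m \<Longrightarrow>
     cyclic_class n m f = {(\<lambda>x. f x + k * (int m + 1)) |k::int. True}"
  by (auto simp: cyclic_class_def cyclic_rel_def cyclic_maps_translate)

lemma equiv_cyclic_rel: "equiv (cyclic_maps n m) (cyclic_rel n m)"
proof (rule equivI)
  show "cyclic_rel n m \<subseteq> cyclic_maps n m \<times> cyclic_maps n m"
    by (auto simp: cyclic_rel_def)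
  show "refl_on (cyclic_maps n m) (cyclic_rel n m)"
    by (auto simp: refl_on_def cyclic_rel_def intro!: exI[of _ 0])
  show "sym (cyclic_rel n m)"
  proof (rule symI)
    fix f g assume "(f, g) \<in> cyclic_rel n m"
    then obtain k where "f \<in> cyclic_maps n m" "g \<in> cyclic_maps n m"
      "g = (\<lambda>x. f x + k * (int m + 1))" by (auto simp: cyclic_rel_def)
    then show "(g, f) \<in> cyclic_rel n m"
      by (auto simp: cyclic_rel_def intro!: exI[of _ "- k"])
  qed
  show "trans (cyclic_rel n m)"
  proof (rule transI)
    fix f g h assume "(f, g) \<in> cyclic_rel n m" "(g, h) \<in> cyclic_rel n m"
    then obtain k k' where "f \<in> cyclic_maps n m" "h \<in> cyclic_maps n m"
      "g = (\<lambda>x. f x + k * (int m + 1))" "h = (\<lambda>x. g x + k' * (int m + 1))"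
      by (auto simp: cyclic_rel_def)
    then show "(f, h) \<in> cyclic_rel n m"
      by (auto simp: cyclic_rel_def algebra_simps intro!: exI[of _ "k + k'"])
  qed
qed

lemma cyclic_hom_cases:
  assumes "\<phi> \<in> cat_hom cyclic_cat n m"
  obtains f where "f \<in> cyclic_maps n m" "\<phi> = cyclic_class n m f"
  using assms by (auto simp: cyclic_cat_def cyclic_class_def quotient_def)

lemma cyclic_class_hom:
  "f \<in> cyclic_maps n m \<Longrightarrow> cyclic_class n m f \<in> cat_hom cyclic_cat n m"
  by (auto simp: cyclic_cat_def cyclic_class_def quotient_def)

lemma cyclic_comp_class:
  assumes f: "f \<in> cyclic_maps n m" and g: "g \<in> cyclic_maps m l"
  shows "cat_comp cyclic_cat n m l (cyclic_class m l g) (cyclic_class n m f)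
           = cyclic_class n l (g \<circ> f)"
proof -
  have *: "(\<lambda>x. g x + k * (int l + 1)) \<circ> (\<lambda>x. f x + k' * (int m + 1))
             = (\<lambda>x. (g \<circ> f) x + (k + k') * (int l + 1))" for k k'
    unfolding o_def cyclic_maps_shift[OF g] by (simp add: algebra_simps)
  show ?thesis
    unfolding cyclic_class_eq[OF f] cyclic_class_eq[OF g]
      cyclic_class_eq[OF cyclic_maps_comp[OF f g]] cyclic_cat_def category.simps
  proof (intro subset_antisym subsetI)
    fix h assume "h \<in> {(\<lambda>x. (g \<circ> f) x + k * (int l + 1)) |k. True}"
    then obtain k where "h = (\<lambda>x. (g \<circ> f) x + (k + 0) * (int l + 1))" by auto
    then have "h = (\<lambda>x. g x + k * (int l + 1)) \<circ> (\<lambda>x. f x + 0 * (int m + 1))"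
      by (simp only: *)
    then show "h \<in> {g' \<circ> f' |g' f'. g' \<in> {(\<lambda>x. g x + k * (int l + 1)) |k. True} \<and>
        f' \<in> {(\<lambda>x. f x + k * (int m + 1)) |k. True}}" by blast
  qed (use * in blast)
qed

lemma is_category_simplex_cat: "is_category simplex_cat"
  unfolding is_category_def simplex_cat_def category.simps
  by (auto simp: mono_on_def compose_def PiE_iff extensional_def fun_eq_iff restrict_def)

lemma is_category_cyclic_cat: "is_category cyclic_cat"
proof -
  have id: "cat_id cyclic_cat n = cyclic_class n n (\<lambda>x. x)" for n
    by (simp add: cyclic_cat_def)
  show ?thesis
    unfolding is_category_def
    by (auto simp: id cyclic_comp_class cyclic_maps_id cyclic_maps_comp o_def[of _ "\<lambda>x. x"]
        o_def[of "\<lambda>x. x"] o_assoc intro!: cyclic_class_hom elim!: cyclic_hom_cases)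
qed

lemma simplex_lift_eq:
  assumes "x \<le> n"
  shows "simplex_lift n m f (int x + k * (int n + 1)) = int (f x) + k * (int m + 1)"
  using assms by (simp add: simplex_lift_def)

lemma simplex_lift_cyclic:
  assumes f: "f \<in> cat_hom simplex_cat n m"
  shows "simplex_lift n m f \<in> cyclic_maps n m"
proof -
  have mono: "f x \<le> f y" if "x \<le> y" "y \<le> n" for x y
    using f that by (auto simp: simplex_cat_def mono_on_def)
  have bound: "f x \<le> m" if "x \<le> n" for x
    using f that by (auto simp: simplex_cat_def)
  have decomp: "\<exists>x k. x \<le> n \<and> y = int x + k * (int n + 1)" for y
  proof (intro exI conjI)
    show "nat (y mod (int n + 1)) \<le> n"
      using pos_mod_bound[of "int n + 1" y] by linarith
    show "y = int (nat (y mod (int n + 1))) + (y div (int n + 1)) * (int n + 1)"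
      using pos_mod_sign[of "int n + 1" y] by (simp add: mod_div_mult_eq)
  qed
  have "simplex_lift n m f y \<le> simplex_lift n m f y'" if le: "y \<le> y'" for y y'
  proof -
    obtain x k where y: "x \<le> n" "y = int x + k * (int n + 1)" using decomp by blast
    obtain x' k' where y': "x' \<le> n" "y' = int x' + k' * (int n + 1)" using decomp by blast
    have "k \<le> k'"
    proof (rule ccontr)
      assume "\<not> k \<le> k'"
      then have "(k' + 1) * (int n + 1) \<le> k * (int n + 1)" by (intro mult_right_mono) auto
      then show False using y y' le by (simp add: algebra_simps)
    qed
    then consider "k = k'" | "k + 1 \<le> k'" by linarith
    then show ?thesis
    proof cases
      case 1
      then show ?thesis using y y' le mono by (simp add: simplex_lift_eq)
    next
      case 2
      then have "(k + 1) * (int m + 1) \<le> k' * (int m + 1)" by (intro mult_right_mono) auto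
      then show ?thesis using bound[OF y(1)]
        unfolding y(2) y'(2) simplex_lift_eq[OF y(1)] simplex_lift_eq[OF y'(1)]
        by (simp add: algebra_simps)
    qed
  qed
  moreover have "simplex_lift n m f (y + int n + 1) = simplex_lift n m f y + int m + 1" for y
  proof -
    obtain x k where y: "x \<le> n" "y = int x + k * (int n + 1)" using decomp by blast
    then have "y + int n + 1 = int x + (k + 1) * (int n + 1)" by (simp add: algebra_simps)
    then show ?thesis using y by (simp only: simplex_lift_eq) (simp add: algebra_simps)
  qed
  ultimately show ?thesis by (auto simp: cyclic_maps_def mono_def)
qed

lemma simplex_to_cyclic_hom:
  "f \<in> cat_hom simplex_cat n m \<Longrightarrow> simplex_to_cyclic n m f \<in> cat_hom cyclic_cat n m"
  unfolding simplex_to_cyclic_def by (intro cyclic_class_hom simplex_lift_cyclic)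

lemma simplex_to_cyclic_id:
  "simplex_to_cyclic n n (cat_id simplex_cat n) = cat_id cyclic_cat n"
proof -
  have "nat (y mod (int n + 1)) \<le> n" for y
    using pos_mod_bound[of "int n + 1" y] by linarith
  then have "simplex_lift n n (cat_id simplex_cat n) = (\<lambda>x. x)"
    by (auto simp: simplex_lift_def simplex_cat_def mod_div_mult_eq)
  then show ?thesis by (simp add: simplex_to_cyclic_def cyclic_cat_def)
qed

lemma simplex_to_cyclic_comp:
  assumes f: "f \<in> cat_hom simplex_cat n m" and g: "g \<in> cat_hom simplex_cat m l"
  shows "simplex_to_cyclic n l (cat_comp simplex_cat n m l g f)
           = cat_comp cyclic_cat n m l (simplex_to_cyclic m l g) (simplex_to_cyclic n m f)"
proof -
  have "simplex_lift n l (cat_comp simplex_cat n m l g f)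
          = simplex_lift m l g \<circ> simplex_lift n m f"
  proof
    fix y
    have x: "nat (y mod (int n + 1)) \<le> n"
      using pos_mod_bound[of "int n + 1" y] by linarith
    then have "f (nat (y mod (int n + 1))) \<le> m" using f by (auto simp: simplex_cat_def)
    from simplex_lift_eq[OF this, of l g "y div (int n + 1)"] x
    show "simplex_lift n l (cat_comp simplex_cat n m l g f) y
            = (simplex_lift m l g \<circ> simplex_lift n m f) y"
      by (simp add: simplex_lift_def[of n] simplex_cat_def compose_def)
  qed
  then show ?thesis
    by (simp add: simplex_to_cyclic_def cyclic_comp_class simplex_lift_cyclic f g)
qed

lemma dual_map_le_iff:
  assumes f: "f \<in> cat_hom simplex_cat n m" and i: "i \<le> n"
  shows "dual_map n f j \<le> i \<longleftrightarrow> j \<le> f i"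
proof
  assume le: "dual_map n f j \<le> i"
  then have ex: "\<exists>i\<in>{0..n}. j \<le> f i" using i by (auto simp: dual_map_def split: if_splits)
  let ?S = "{i \<in> {0..n}. j \<le> f i}"
  have "Min ?S \<in> ?S" using ex by (intro Min_in) auto
  moreover have "dual_map n f j = Min ?S" using ex by (simp add: dual_map_def)
  ultimately have "j \<le> f (dual_map n f j)" by auto
  also have "\<dots> \<le> f i" using f i le by (auto simp: simplex_cat_def mono_on_def)
  finally show "j \<le> f i" .
next
  assume "j \<le> f i"
  then show "dual_map n f j \<le> i" using i by (auto simp: dual_map_def intro!: Min_le)
qed

lemma dual_map_le:
  assumes f: "f \<in> cat_hom simplex_cat n m"
  shows "dual_map n f j \<le> n + 1"
proof (cases "\<exists>i\<in>{0..n}. j \<le> f i")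
  case True
  then obtain i where "i \<le> n" "j \<le> f i" by auto
  then show ?thesis using dual_map_le_iff[OF f, of i j] by auto
qed (auto simp: dual_map_def)

lemma dual_map_unique:
  assumes f: "f \<in> cat_hom simplex_cat n m" and "a \<le> n + 1"
    and "\<And>i. i \<le> n \<Longrightarrow> a \<le> i \<longleftrightarrow> j \<le> f i"
  shows "dual_map n f j = a"
proof -
  have *: "dual_map n f j \<le> i \<longleftrightarrow> a \<le> i" if "i \<le> n" for i
    using dual_map_le_iff[OF f that] assms(3)[OF that] by simp
  show ?thesis
    using *[of a] *[of "dual_map n f j"] dual_map_le[OF f, of j] assms(2)
    by (cases "a \<le> n"; cases "dual_map n f j \<le> n") auto
qed

lemma dual_map_0: "f \<in> cat_hom simplex_cat n m \<Longrightarrow> dual_map n f 0 = 0"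
  by (rule dual_map_unique) auto

lemma dual_map_top:
  assumes "f \<in> cat_hom simplex_cat n m"
  shows "dual_map n f (m + 1) = n + 1"
proof -
  have "f i \<le> m" if "i \<le> n" for i using assms that by (auto simp: simplex_cat_def)
  then show ?thesis by (intro dual_map_unique[OF assms]) fastforce+
qed

lemma dual_map_mono:
  assumes f: "f \<in> cat_hom simplex_cat n m" and "j \<le> j'"
  shows "dual_map n f j \<le> dual_map n f j'"
proof (cases "dual_map n f j' \<le> n")
  case True
  then have "j' \<le> f (dual_map n f j')" using dual_map_le_iff[OF f] by blast
  then show ?thesis using dual_map_le_iff[OF f True] assms(2) by simp
next
  case False
  then show ?thesis using dual_map_le[OF f, of j] by simp
qed

lemma dual_map_id:
  assumes "j \<le> n + 1"
  shows "dual_map n (cat_id simplex_cat n) j = j"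
proof (rule dual_map_unique)
  show "cat_id simplex_cat n \<in> cat_hom simplex_cat n n"
    using is_category_simplex_cat by (auto simp: is_category_def)
qed (use assms in \<open>auto simp: simplex_cat_def\<close>)

lemma dual_map_comp:
  assumes f: "f \<in> cat_hom simplex_cat n m" and g: "g \<in> cat_hom simplex_cat m l"
  shows "dual_map n (cat_comp simplex_cat n m l g f) j = dual_map n f (dual_map m g j)"
proof (rule dual_map_unique)
  show "cat_comp simplex_cat n m l g f \<in> cat_hom simplex_cat n l"
    using is_category_simplex_cat f g unfolding is_category_def by blast
  show "dual_map n f (dual_map m g j) \<le> n + 1" by (rule dual_map_le[OF f])
  fix i assume i: "i \<le> n"
  then have "f i \<le> m" using f by (auto simp: simplex_cat_def)
  then show "dual_map n f (dual_map m g j) \<le> i \<longleftrightarrow> j \<le> cat_comp simplex_cat n m l g f i"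
    using i by (simp add: dual_map_le_iff[OF f] dual_map_le_iff[OF g] simplex_cat_def compose_def)
qed

lemma set_functor_interval_point:
  fixes I :: "'a set"
  shows "set_functor simplex_cat (interval_point I leq b t)"
proof -
  let ?F = "interval_seqs I leq b t"
  have maps: "(\<lambda>j\<in>{0..m+1}. \<beta> (dual_map n f j)) \<in> ?F m"
    if f: "f \<in> cat_hom simplex_cat n m" and \<beta>: "\<beta> \<in> ?F n" for n m f \<beta>
  proof -
    have "\<beta> (dual_map n f j) \<in> I" for j
      using \<beta> dual_map_le[OF f, of j] by (auto simp: interval_seqs_def)
    moreover have "leq (\<beta> (dual_map n f i)) (\<beta> (dual_map n f j))" if "i \<le> j" for i j
      using \<beta> dual_map_le[OF f, of i] dual_map_le[OF f, of j] dual_map_mono[OF f that]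
      by (auto simp: interval_seqs_def monotone_on_def)
    moreover have "\<beta> 0 = b" "\<beta> (n + 1) = t" using \<beta> by (auto simp: interval_seqs_def)
    ultimately show ?thesis
      using dual_map_0[OF f] dual_map_top[OF f]
      by (auto simp: interval_seqs_def monotone_on_def)
  qed
  have id: "cat_id simplex_cat n \<in> cat_hom simplex_cat n n"
    and comp: "\<And>f g. f \<in> cat_hom simplex_cat n m \<Longrightarrow> g \<in> cat_hom simplex_cat m l \<Longrightarrow>
      cat_comp simplex_cat n m l g f \<in> cat_hom simplex_cat n l" for n m l
    using is_category_simplex_cat unfolding is_category_def by blast+
  have 1: "(\<lambda>j\<in>{0..n+1}. \<beta> (dual_map n (cat_id simplex_cat n) j)) = \<beta>" if "\<beta> \<in> ?F n" for n \<beta>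
    using that by (auto simp: dual_map_id interval_seqs_def PiE_iff extensional_def fun_eq_iff)
  have 2: "(\<lambda>j\<in>{0..l+1}. \<beta> (dual_map n (cat_comp simplex_cat n m l g f) j))
      = (\<lambda>j\<in>{0..l+1}. (\<lambda>i\<in>{0..m+1}. \<beta> (dual_map n f i)) (dual_map m g j))"
    if "f \<in> cat_hom simplex_cat n m" "g \<in> cat_hom simplex_cat m l" for n m l f g
      and \<beta> :: "nat \<Rightarrow> 'a"
    using dual_map_le[OF that(2)] by (simp add: dual_map_comp[OF that])
  show ?thesis
    unfolding set_functor_def interval_point_def set_diagram.simps
  proof (intro conjI allI ballI)
    fix n
    show "restrict (\<lambda>f. \<lambda>\<beta>\<in>?F n. \<lambda>j\<in>{0..n+1}. \<beta> (dual_map n f j))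
        (cat_hom simplex_cat n n) (cat_id simplex_cat n) = (\<lambda>u\<in>?F n. u)"
      using id[of n] 1[of _ n] by (simp add: fun_eq_iff restrict_def)
  next
    fix n m l f g
    assume fg: "f \<in> cat_hom simplex_cat n m" "g \<in> cat_hom simplex_cat m l"
    show "restrict (\<lambda>f. \<lambda>\<beta>\<in>?F n. \<lambda>j\<in>{0..l+1}. \<beta> (dual_map n f j))
        (cat_hom simplex_cat n l) (cat_comp simplex_cat n m l g f) =
      compose (?F n)
        (restrict (\<lambda>f. \<lambda>\<beta>\<in>?F m. \<lambda>j\<in>{0..l+1}. \<beta> (dual_map m f j)) (cat_hom simplex_cat m l) g)
        (restrict (\<lambda>f. \<lambda>\<beta>\<in>?F n. \<lambda>j\<in>{0..m+1}. \<beta> (dual_map n f j)) (cat_hom simplex_cat n m) f)"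
    proof
      fix \<beta>
      show "restrict (\<lambda>f. \<lambda>\<beta>\<in>?F n. \<lambda>j\<in>{0..l+1}. \<beta> (dual_map n f j))
          (cat_hom simplex_cat n l) (cat_comp simplex_cat n m l g f) \<beta> =
        compose (?F n)
          (restrict (\<lambda>f. \<lambda>\<beta>\<in>?F m. \<lambda>j\<in>{0..l+1}. \<beta> (dual_map m f j)) (cat_hom simplex_cat m l) g)
          (restrict (\<lambda>f. \<lambda>\<beta>\<in>?F n. \<lambda>j\<in>{0..m+1}. \<beta> (dual_map n f j)) (cat_hom simplex_cat n m) f) \<beta>"
      proof (cases "\<beta> \<in> ?F n")
        case True
        show ?thesis
          unfolding compose_eq[OF True] restrict_apply'[OF fg(1)] restrict_apply'[OF fg(2)]
            restrict_apply'[OF comp[OF fg]] restrict_apply'[OF True]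
            restrict_apply'[OF maps[OF fg(1) True]]
          by (rule 2[OF fg])
      qed (simp add: compose_def comp[OF fg])
    qed
  qed (use maps in auto)
qed

end

theory Submission
  imports Defs
begin

text \<open>A sequence \<open>\<beta>\<close> in \<open>\<F>\<^sub>I([n])\<close> extends to the nondecreasing map \<open>B : \<int> \<rightarrow> G\<close> with
  \<open>B(r + k(n+1)) = z\<^sup>k \<beta>\<^sub>r\<close>. A periodic monotone \<open>f\<close> has a left adjoint \<open>f\<^sup>*\<close>, and
  \<open>(f\<^sub>*\<beta>)\<^sub>j = B(f\<^sup>*(0))\<^sup>-\<^sup>1 B(f\<^sup>*(j))\<close> is functorial because \<open>(gf)\<^sup>* = f\<^sup>*g\<^sup>*\<close>; replacing \<open>f\<close> by
  \<open>f + k(m+1)\<close> multiplies \<open>B \<circ> f\<^sup>*\<close> by a power of the central element \<open>z\<close>, which cancels.\<close>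

section \<open>Duals of periodic maps\<close>

text \<open>The cyclic counterpart of \<^const>\<open>dual_map\<close>: the left adjoint of a periodic monotone map.\<close>

definition cyclic_dual :: "(int \<Rightarrow> int) \<Rightarrow> int \<Rightarrow> int" where
  "cyclic_dual f y = (THE a. \<forall>x. a \<le> x \<longleftrightarrow> y \<le> f x)"

lemma cyclic_dual_unique:
  assumes "\<And>x. a \<le> x \<longleftrightarrow> y \<le> f x"
  shows "cyclic_dual f y = a"
  unfolding cyclic_dual_def
proof (rule the_equality)
  fix b assume b: "\<forall>x. b \<le> x \<longleftrightarrow> y \<le> f x"
  show "b = a" using b assms by (meson order_antisym order_refl)
qed (use assms in simp)

text \<open>Periodicity makes \<open>f\<close> unbounded in both directions, so the points
  \<open>x\<close> with \<open>y \<le> f x\<close> form a nonempty up-set that is bounded below and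
  hence has a least element.\<close>

lemma cyclic_dual_le_iff:
  assumes f: "f \<in> cyclic_maps n m"
  shows "cyclic_dual f y \<le> x \<longleftrightarrow> y \<le> f x"
proof -
  have mono: "f u \<le> f v" if "u \<le> v" for u v
    using f that by (auto simp: cyclic_maps_def mono_def)
  have shift: "f (k * (int n + 1)) = f 0 + k * (int m + 1)" for k
    using cyclic_maps_shift[OF f, of 0 k] by simp
  \<comment> \<open>Shifting by \<open>c\<close> periods carries \<open>f 0\<close> past
    \<open>y\<close> either way:
    \<open>f (- c * (int n + 1)) < y \<le> f (c * (int n + 1))\<close>.\<close>
  define c where "c = \<bar>y\<bar> + \<bar>f 0\<bar> + 1"
  have c: "c \<le> c * (int m + 1)" "f 0 - y < c" "y - f 0 \<le> c"
    unfolding c_def by (auto simp: algebra_simps)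
  define L where "L = - c * (int n + 1)"
  have L: "f L < y" using shift[of "- c"] c unfolding L_def by linarith
  have U: "y \<le> f (c * (int n + 1))" using shift[of c] c by linarith
  \<comment> \<open>Counting from \<open>L\<close>, which lies strictly below the up-set, turns the
    search into one for a least natural number.\<close>
  define S where "S d \<longleftrightarrow> y \<le> f (L + int d)" for d
  have "0 \<le> c * (int n + 1)" unfolding c_def by simp
  then have S: "S (nat (2 * (c * (int n + 1))))" using U by (simp add: S_def L_def)
  have "(L + int (Least S) \<le> x) = (y \<le> f x)" for x
  proof
    assume "L + int (Least S) \<le> x"
    then show "y \<le> f x" using LeastI[of S, OF S] mono order_trans unfolding S_def by blast
  next
    assume y: "y \<le> f x"
    then have "L \<le> x" using L mono[of x L] by linarith
    then have "S (nat (x - L))" using y by (simp add: S_def)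
    then have "Least S \<le> nat (x - L)" by (rule Least_le)
    then show "L + int (Least S) \<le> x" using \<open>L \<le> x\<close> by linarith
  qed
  then show ?thesis using cyclic_dual_unique by metis
qed

lemma cyclic_dual_mono:
  assumes f: "f \<in> cyclic_maps n m" and "y \<le> y'"
  shows "cyclic_dual f y \<le> cyclic_dual f y'"
  using assms(2) cyclic_dual_le_iff[OF f] order_refl order_trans by metis

lemma cyclic_dual_shift:
  assumes f: "f \<in> cyclic_maps n m"
  shows "cyclic_dual f (y + k * (int m + 1)) = cyclic_dual f y + k * (int n + 1)"
proof (rule cyclic_dual_unique)
  fix x
  have "f x = f (x - k * (int n + 1)) + k * (int m + 1)"
    using cyclic_maps_shift[OF f, of "x - k * (int n + 1)" k] by simp
  moreover have "cyclic_dual f y \<le> x - k * (int n + 1) \<longleftrightarrow> y \<le> f (x - k * (int n + 1))"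
    by (rule cyclic_dual_le_iff[OF f])
  ultimately show "cyclic_dual f y + k * (int n + 1) \<le> x \<longleftrightarrow> y + k * (int m + 1) \<le> f x"
    by auto
qed

lemma cyclic_dual_translate:
  assumes f: "f \<in> cyclic_maps n m"
  shows "cyclic_dual (\<lambda>x. f x + c) y = cyclic_dual f (y - c)"
  by (rule cyclic_dual_unique) (auto simp: cyclic_dual_le_iff[OF f])

lemma cyclic_dual_comp:
  assumes f: "f \<in> cyclic_maps n m" and g: "g \<in> cyclic_maps m l"
  shows "cyclic_dual (g \<circ> f) y = cyclic_dual f (cyclic_dual g y)"
  by (rule cyclic_dual_unique) (simp add: cyclic_dual_le_iff[OF f] cyclic_dual_le_iff[OF g])

lemma cyclic_dual_add: "cyclic_dual (\<lambda>x. x + c) y = y - c"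
  by (rule cyclic_dual_unique) auto

text \<open>Ties the new dual to the simplicial one. On \<open>{0..n}\<close> both solve the same
  inequality; below 0 the lift is negative, and above \<open>n\<close> it is at least
  \<open>m + 1\<close>, which matches the default \<open>n + 1\<close> of
  \<open>dual_map\<close>.\<close>

lemma cyclic_dual_simplex_lift:
  assumes f: "f \<in> cat_hom simplex_cat n m" and j: "j \<le> m + 1"
  shows "cyclic_dual (simplex_lift n m f) (int j) = int (dual_map n f j)"
proof (rule cyclic_dual_unique)
  let ?h = "simplex_lift n m f"
  have mono: "?h x \<le> ?h y" if "x \<le> y" for x y
    using simplex_lift_cyclic[OF f] that by (auto simp: cyclic_maps_def mono_def)
  have bound: "f i \<le> m" if "i \<le> n" for i using f that by (auto simp: simplex_cat_def)
  fix x
  consider "x < 0" | i where "x = int i" "i \<le> n" | "int n + 1 \<le> x"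
    by (metis add1_zle_eq not_less zero_le_imp_eq_int zle_int)
  then show "int (dual_map n f j) \<le> x \<longleftrightarrow> int j \<le> ?h x"
  proof cases
    case 1
    have "?h x \<le> ?h (int n + (-1) * (int n + 1))" using 1 by (intro mono) simp
    also have "\<dots> < 0" using bound[of n] by (subst simplex_lift_eq) auto
    finally show ?thesis using 1 by linarith
  next
    case (2 i)
    have "?h x = int (f i)" using simplex_lift_eq[OF 2(2), of m f 0] 2(1) by simp
    then show ?thesis using dual_map_le_iff[OF f 2(2), of j] 2 by simp
  next
    case 3
    have "int j \<le> int m + 1" using j by simp
    also have "\<dots> \<le> ?h (int 0 + 1 * (int n + 1))" by (subst simplex_lift_eq) auto
    also have "\<dots> \<le> ?h x" using 3 by (intro mono) simp
    finally show ?thesis using 3 dual_map_le[OF f, of j] by simp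
  qed
qed


section \<open>Uniqueness of cyclic structures\<close>

lemma rotation_cyclic_maps: "(\<lambda>x. x - c) \<in> cyclic_maps n n"
  by (auto simp: cyclic_maps_def mono_def)

text \<open>A periodic map is determined by its values on one period, and monotonicity confines
  these to \<open>{0..m}\<close> once the two end values lie there.\<close>

lemma simplex_lift_restrict:
  assumes h: "h \<in> cyclic_maps n m" and h0: "h 0 \<ge> 0" and hn: "h (int n) \<le> int m"
  defines "g \<equiv> \<lambda>i\<in>{0..n}. nat (h (int i))"
  shows "g \<in> cat_hom simplex_cat n m" and "simplex_lift n m g = h"
proof -
  have mono: "h u \<le> h v" if "u \<le> v" for u v
    using h that by (auto simp: cyclic_maps_def mono_def)
  have pos: "0 \<le> h (int i)" for i using h0 mono[of 0 "int i"] by simp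
  have le: "h (int i) \<le> int m" if "i \<le> n" for i using hn mono[of "int i" "int n"] that by simp
  show "g \<in> cat_hom simplex_cat n m"
    using pos le mono by (auto simp: g_def simplex_cat_def mono_on_def nat_le_iff nat_mono)
  show "simplex_lift n m g = h"
  proof
    fix y
    have p: "0 \<le> y mod (int n + 1)" "nat (y mod (int n + 1)) \<le> n"
      using pos_mod_bound[of "int n + 1" y] by auto
    have "0 \<le> h (y mod (int n + 1))" using h0 mono[OF p(1)] by simp
    then show "simplex_lift n m g y = h y"
      using cyclic_maps_shift[OF h, of "y mod (int n + 1)" "y div (int n + 1)"] p
      by (simp add: simplex_lift_def g_def mod_div_mult_eq)
  qed
qed

text \<open>Every arrow of the cyclic category is a simplicial one after a power of \<open>\<tau>\<close>: rotating by
  \<open>cyclic_dual f 0\<close> makes the representative map \<open>[n]\<close> into \<open>[m]\<close>.\<close>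

lemma cyclic_hom_factor:
  assumes "\<phi> \<in> cat_hom cyclic_cat n m"
  obtains g a where "g \<in> cat_hom simplex_cat n m"
    "\<phi> = cat_comp cyclic_cat n n m (simplex_to_cyclic n m g)
           (cyclic_class n n (\<lambda>x. x - int a))"
proof -
  obtain f0 where f0: "f0 \<in> cyclic_maps n m" and \<phi>: "\<phi> = cyclic_class n m f0"
    using assms by (rule cyclic_hom_cases)
  let ?d = "cyclic_dual f0 0"
  \<comment> \<open>a representative whose dual is nonnegative at 0\<close>
  define f where "f = (\<lambda>x. f0 x + (- \<bar>?d\<bar>) * (int m + 1))"
  have f: "f \<in> cyclic_maps n m" unfolding f_def by (rule cyclic_maps_translate[OF f0])
  have "(f0, f) \<in> cyclic_rel n m" using f0 f unfolding cyclic_rel_def f_def by blast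
  then have \<phi>: "\<phi> = cyclic_class n m f"
    unfolding \<phi> cyclic_class_def by (rule equiv_class_eq[OF equiv_cyclic_rel])
  have "cyclic_dual f 0 = cyclic_dual f0 (0 + \<bar>?d\<bar> * (int m + 1))"
    unfolding f_def by (subst cyclic_dual_translate[OF f0]) simp
  also have "\<dots> = ?d + \<bar>?d\<bar> * (int n + 1)" by (rule cyclic_dual_shift[OF f0])
  also have "\<dots> \<ge> 0"
    using mult_left_mono[of 1 "int n + 1" "\<bar>?d\<bar>"] by simp
  \<comment> \<open>Nonnegativity makes the rotation a natural power of \<open>tau n\<close>, within
    reach of induction.\<close>
  finally obtain a where a: "cyclic_dual f 0 = int a" using zero_le_imp_eq_int by blast
  define h where "h = (\<lambda>x. f (x + int a))"
  have h: "h \<in> cyclic_maps n m"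
    unfolding h_def using cyclic_maps_comp[OF rotation_cyclic_maps[of "- int a"] f]
    by (simp add: o_def)
  \<comment> \<open>\<open>int a\<close> is the least point where \<open>f\<close> is nonnegative,
    so \<open>h (-1) < 0 \<le> h 0\<close>; one period on, the first inequality becomes
    \<open>h (int n) \<le> int m\<close>.\<close>
  have h0: "h 0 \<ge> 0" using cyclic_dual_le_iff[OF f, of 0 "int a"] a by (simp add: h_def)
  have "h (-1) < 0" using cyclic_dual_le_iff[OF f, of 0 "int a - 1"] a by (simp add: h_def)
  moreover have "h (int n) = h (-1) + int m + 1"
    using cyclic_maps_shift[OF h, of "-1" 1] by simp
  ultimately have hn: "h (int n) \<le> int m" by linarith
  note g = simplex_lift_restrict[OF h h0 hn]
  have "h \<circ> (\<lambda>x. x - int a) = f" by (auto simp: h_def)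
  then have "\<phi> = cat_comp cyclic_cat n n m (simplex_to_cyclic n m (\<lambda>i\<in>{0..n}. nat (h (int i))))
           (cyclic_class n n (\<lambda>x. x - int a))"
    unfolding simplex_to_cyclic_def g(2) \<phi>
    by (simp add: cyclic_comp_class[OF rotation_cyclic_maps h])
  with g(1) show ?thesis by (rule that)
qed

lemma set_functor_comp:
  assumes "set_functor C T" "f \<in> cat_hom C x y" "g \<in> cat_hom C y w"
  shows "on_arr T x w (cat_comp C x y w g f) = compose (on_obj T x) (on_arr T y w g) (on_arr T x y f)"
  using assms unfolding set_functor_def by blast

lemma cyclic_structure_on_obj:
  "cyclic_structure I leq b t T \<Longrightarrow> on_obj T = interval_seqs I leq b t"
  unfolding cyclic_structure_def restrict_along_def interval_point_def by simp

lemma cyclic_structure_on_arr_simplex: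
  assumes "cyclic_structure I leq b t T" and g: "g \<in> cat_hom simplex_cat n m"
  shows "on_arr T n m (simplex_to_cyclic n m g) = on_arr (interval_point I leq b t) n m g"
proof -
  have "on_arr (restrict_along simplex_cat simplex_to_cyclic T) n m g
      = on_arr (interval_point I leq b t) n m g"
    using assms(1) by (simp add: cyclic_structure_def)
  then show ?thesis using g by (simp add: restrict_along_def)
qed

text \<open>Simplicial arrows and the \<open>tau n\<close> generate \<open>cyclic_cat\<close>
  (\<open>cyclic_hom_factor\<close>), and the point prescribes the action of the former.
  Extensionality upgrades agreement on arguments to equality of records.\<close>

lemma cyclic_structure_unique:
  assumes T: "cyclic_structure I leq b t T" and T': "cyclic_structure I leq b t T'"
    and tau: "\<And>n \<beta>. \<beta> \<in> interval_seqs I leq b t n \<Longrightarrow>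
      on_arr T n n (tau n) \<beta> = on_arr T' n n (tau n) \<beta>"
  shows "T = T'"
proof -
  have fT: "set_functor cyclic_cat T" "set_functor cyclic_cat T'"
    using T T' by (auto simp: cyclic_structure_def)
  have ext: "on_arr S n m \<in> cat_hom cyclic_cat n m \<rightarrow>\<^sub>E (on_obj S n \<rightarrow>\<^sub>E on_obj S m)"
    if "set_functor cyclic_cat S" for S :: "(nat, (int \<Rightarrow> int) set, nat \<Rightarrow> 'a) set_diagram" and n m
    using that unfolding set_functor_def by blast
  have obj: "on_obj T = on_obj T'"
    using cyclic_structure_on_obj[OF T] cyclic_structure_on_obj[OF T'] by simp
  have tau_hom: "tau n \<in> cat_hom cyclic_cat n n" for n
    unfolding tau_def by (intro cyclic_class_hom rotation_cyclic_maps)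
  have tau_eq: "on_arr T n n (tau n) = on_arr T' n n (tau n)" for n
  proof (rule PiE_ext)
    show "on_arr T n n (tau n) \<in> on_obj T n \<rightarrow>\<^sub>E on_obj T n"
      using PiE_mem[OF ext[OF fT(1)] tau_hom] .
    show "on_arr T' n n (tau n) \<in> on_obj T n \<rightarrow>\<^sub>E on_obj T n"
      using PiE_mem[OF ext[OF fT(2)] tau_hom] obj by simp
  qed (use tau cyclic_structure_on_obj[OF T] in simp)
  have rot: "on_arr T n n (cyclic_class n n (\<lambda>x. x - int a))
      = on_arr T' n n (cyclic_class n n (\<lambda>x. x - int a))" for n a
  proof (induction a)
    case 0
    have "cyclic_class n n (\<lambda>x. x - int 0) = cat_id cyclic_cat n" by (simp add: cyclic_cat_def)
    then show ?case using fT obj unfolding set_functor_def by simp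
  next
    case (Suc a)
    have "(\<lambda>x. x - 1) \<circ> (\<lambda>x. x - int a) = (\<lambda>x. x - int (Suc a))" by auto
    then have "cyclic_class n n (\<lambda>x. x - int (Suc a))
        = cat_comp cyclic_cat n n n (tau n) (cyclic_class n n (\<lambda>x. x - int a))"
      by (simp add: tau_def cyclic_comp_class rotation_cyclic_maps)
    then show ?case
      using Suc tau_eq obj fT tau_hom cyclic_class_hom[OF rotation_cyclic_maps]
      by (simp add: set_functor_comp)
  qed
  have "on_arr T n m \<phi> = on_arr T' n m \<phi>" for n m \<phi>
  proof (cases "\<phi> \<in> cat_hom cyclic_cat n m")
    case True
    then obtain g a where g: "g \<in> cat_hom simplex_cat n m" and
      \<phi>: "\<phi> = cat_comp cyclic_cat n n m (simplex_to_cyclic n m g)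
           (cyclic_class n n (\<lambda>x. x - int a))"
      by (rule cyclic_hom_factor)
    show ?thesis unfolding \<phi>
      using g rot obj fT simplex_to_cyclic_hom[OF g] cyclic_class_hom[OF rotation_cyclic_maps]
      by (simp add: set_functor_comp cyclic_structure_on_arr_simplex[OF T]
          cyclic_structure_on_arr_simplex[OF T'])
  next
    case False
    then show ?thesis using PiE_arb[OF ext[OF fT(1)]] PiE_arb[OF ext[OF fT(2)]] by simp
  qed
  then have "on_arr T = on_arr T'" by blast
  with obj show ?thesis by simp
qed


section \<open>The cyclic structure of a central element\<close>

locale left_ordered_group = group G for G (structure) +
  fixes P :: "'a set"
  assumes left_order: "left_order G P"
begin

lemma mult_inv_cancel_left [simp]:
  assumes "a \<in> carrier G" "b \<in> carrier G"
  shows "a \<otimes> (inv a \<otimes> b) = b" and "inv a \<otimes> (a \<otimes> b) = b"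
  using assms by (simp_all flip: m_assoc)

lemma P_closed: "a \<in> P \<Longrightarrow> a \<in> carrier G"
  using left_order by (auto simp: left_order_def)

lemma lo_le_refl: "a \<in> carrier G \<Longrightarrow> lo_le G P a a"
  using left_order by (auto simp: left_order_def lo_le_def)

lemma lo_le_trans:
  assumes c: "a \<in> carrier G" "b \<in> carrier G" "c \<in> carrier G"
    and "lo_le G P a b" "lo_le G P b c"
  shows "lo_le G P a c"
proof -
  have "(inv a \<otimes> b) \<otimes> (inv b \<otimes> c) \<in> P"
    using left_order assms by (auto simp: left_order_def lo_le_def set_mult_def)
  then show ?thesis using c by (simp add: lo_le_def m_assoc)
qed

lemma lo_le_mult_left:
  assumes c: "a \<in> carrier G" "b \<in> carrier G" "c \<in> carrier G"
  shows "lo_le G P (c \<otimes> a) (c \<otimes> b) \<longleftrightarrow> lo_le G P a b"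
  using c by (simp add: lo_le_def inv_mult_group m_assoc)

end

section \<open>Central elements and sequences between the unit and \<open>z\<close>\<close>

locale left_ordered_group_central = left_ordered_group +
  fixes z :: 'a
  assumes z_in_P: "z \<in> P"
    and z_central: "\<And>g. g \<in> carrier G \<Longrightarrow> z \<otimes> g = g \<otimes> z"
begin

abbreviation seqs :: "nat \<Rightarrow> (nat \<Rightarrow> 'a) set" where
  "seqs \<equiv> interval_seqs (lo_interval G P \<one> z) (lo_le G P) \<one> z"

lemma z_closed [simp]: "z \<in> carrier G"
  using z_in_P by (rule P_closed)

text \<open>Unrolling reaches negative integers, so centrality has to pass to inverses of powers as
  well.\<close>

lemma z_pow_comm:
  assumes "g \<in> carrier G"
  shows "z [^] (k::int) \<otimes> g = g \<otimes> z [^] k"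
proof -
  have nat: "z [^] (i::nat) \<otimes> g = g \<otimes> z [^] i" for i
    using group_commutes_pow[OF z_central] assms by simp
  have inv_commutes: "inv a \<otimes> g = g \<otimes> inv a" if "a \<otimes> g = g \<otimes> a" "a \<in> carrier G" for a
  proof -
    have "inv a \<otimes> g = inv a \<otimes> ((g \<otimes> a) \<otimes> inv a)" using that(2) assms by (simp add: m_assoc)
    also have "\<dots> = g \<otimes> inv a" unfolding that(1)[symmetric] using that(2) assms by (simp add: m_assoc)
    finally show ?thesis .
  qed
  show ?thesis
    unfolding int_pow_def2
    by (simp only: nat inv_commutes[OF nat] nat_pow_closed z_closed split: if_split) simp
qed

lemma z_pow_comm3:
  assumes "a \<in> carrier G" "b \<in> carrier G"
  shows "z [^] (k::int) \<otimes> (a \<otimes> b) = a \<otimes> (z [^] k \<otimes> b)"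
  using assms z_pow_comm[of a k] by (simp flip: m_assoc)

lemma seqs_closed: "\<beta> \<in> seqs n \<Longrightarrow> j \<le> n + 1 \<Longrightarrow> \<beta> j \<in> carrier G"
  by (auto simp: interval_seqs_def lo_interval_def)

lemma seqs_0: "\<beta> \<in> seqs n \<Longrightarrow> \<beta> 0 = \<one>"
  and seqs_top: "\<beta> \<in> seqs n \<Longrightarrow> \<beta> (n + 1) = z"
  and seqs_mono: "\<beta> \<in> seqs n \<Longrightarrow> i \<le> j \<Longrightarrow> j \<le> n + 1 \<Longrightarrow> lo_le G P (\<beta> i) (\<beta> j)"
  by (auto simp: interval_seqs_def monotone_on_def)

text \<open>The interval bounds follow from monotonicity, which compares every entry with the end
  entries \<open>\<one>\<close> and \<open>z\<close>.\<close>

lemma seqsI: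
  assumes "\<beta> \<in> extensional {0..n+1}" "\<And>j. j \<le> n + 1 \<Longrightarrow> \<beta> j \<in> carrier G"
    and mono: "\<And>i j. i \<le> j \<Longrightarrow> j \<le> n + 1 \<Longrightarrow> lo_le G P (\<beta> i) (\<beta> j)"
    and "\<beta> 0 = \<one>" "\<beta> (n + 1) = z"
  shows "\<beta> \<in> seqs n"
  using assms mono[of 0] mono[of _ "n + 1"]
  by (auto simp: interval_seqs_def lo_interval_def monotone_on_def PiE_iff)

text \<open>The sequence \<open>\<beta>\<close> as the fundamental domain of a \<open>z\<close>-equivariant map on all integers.\<close>

definition unroll :: "nat \<Rightarrow> (nat \<Rightarrow> 'a) \<Rightarrow> int \<Rightarrow> 'a" where
  "unroll n \<beta> x = z [^] (x div (int n + 1)) \<otimes> \<beta> (nat (x mod (int n + 1)))"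

lemma int_decomp:
  obtains r k where "r \<le> n" "x = int r + k * (int n + 1)"
proof
  show "nat (x mod (int n + 1)) \<le> n" using pos_mod_bound[of "int n + 1" x] by linarith
  show "x = int (nat (x mod (int n + 1))) + (x div (int n + 1)) * (int n + 1)"
    using pos_mod_sign[of "int n + 1" x] by (simp add: mod_div_mult_eq)
qed

context
  fixes n \<beta> assumes \<beta>: "\<beta> \<in> seqs n"
begin

text \<open>The range includes \<open>r = n + 1\<close>, the start of the next period:
  \<open>\<beta> (n + 1) = z\<close> agrees with \<open>z \<otimes> \<beta> 0\<close>, so adjacent
  periods overlap consistently.\<close>

lemma unroll_eq:
  assumes "r \<le> n + 1"
  shows "unroll n \<beta> (int r + k * (int n + 1)) = z [^] k \<otimes> \<beta> r"
proof (cases "r \<le> n")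
  case True
  then show ?thesis by (simp add: unroll_def)
next
  case False
  then have r: "r = n + 1" using assms by simp
  then have "int r + k * (int n + 1) = (k + 1) * (int n + 1)" by (simp add: algebra_simps)
  then have "unroll n \<beta> (int r + k * (int n + 1)) = z [^] (k + 1)"
    using seqs_0[OF \<beta>] by (simp add: unroll_def del: of_nat_Suc)
  then show ?thesis using seqs_top[OF \<beta>] r by (simp add: int_pow_mult)
qed

lemma unroll_of_nat: "r \<le> n + 1 \<Longrightarrow> unroll n \<beta> (int r) = \<beta> r"
  using unroll_eq[of r 0] seqs_closed[OF \<beta>] by simp

lemma unroll_closed: "unroll n \<beta> x \<in> carrier G"
proof -
  obtain r k where "r \<le> n" "x = int r + k * (int n + 1)" by (rule int_decomp)
  then show ?thesis using seqs_closed[OF \<beta>] by (simp add: unroll_eq)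
qed

lemma unroll_shift: "unroll n \<beta> (x + k * (int n + 1)) = z [^] k \<otimes> unroll n \<beta> x"
proof -
  obtain r l where r: "r \<le> n" and x: "x = int r + l * (int n + 1)" by (rule int_decomp)
  have "int r + l * (int n + 1) + k * (int n + 1) = int r + (k + l) * (int n + 1)"
    by (simp add: algebra_simps)
  then show ?thesis unfolding x
    using r seqs_closed[OF \<beta>, of r]
    by (simp only: unroll_eq le_SucI flip: Suc_eq_plus1) (simp add: int_pow_mult m_assoc)
qed

text \<open>Comparing neighbours suffices. They sit at \<open>r\<close> and \<open>Suc r\<close> of
  one period, as \<open>unroll_eq\<close> admits \<open>Suc r = n + 1\<close>, and left translation
  by a power of \<open>z\<close> preserves the order.\<close>

lemma unroll_mono:
  assumes "x \<le> y"
  shows "lo_le G P (unroll n \<beta> x) (unroll n \<beta> y)"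
  using assms
proof (induction y rule: int_ge_induct)
  case base
  show ?case by (intro lo_le_refl unroll_closed)
next
  case (step y)
  obtain r k where r: "r \<le> n" and y: "y = int r + k * (int n + 1)" by (rule int_decomp)
  have y1: "y + 1 = int (Suc r) + k * (int n + 1)" by (simp add: y)
  have "unroll n \<beta> (y + 1) = z [^] k \<otimes> \<beta> (Suc r)"
    unfolding y1 using r by (intro unroll_eq) simp
  moreover have "unroll n \<beta> y = z [^] k \<otimes> \<beta> r" using unroll_eq[of r k] r y by simp
  ultimately have "lo_le G P (unroll n \<beta> y) (unroll n \<beta> (y + 1))"
    using r seqs_closed[OF \<beta>] seqs_mono[OF \<beta>, of r "Suc r"] by (simp add: lo_le_mult_left)
  then show ?case using step.IH lo_le_trans unroll_closed by blast
qed

end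

section \<open>Action of periodic maps on sequences\<close>

text \<open>Dividing by the value at \<open>cyclic_dual f 0\<close> puts the smallest entry back to \<open>\<one>\<close>.\<close>

definition push :: "nat \<Rightarrow> nat \<Rightarrow> (int \<Rightarrow> int) \<Rightarrow> (nat \<Rightarrow> 'a) \<Rightarrow> nat \<Rightarrow> 'a" where
  "push n m f \<beta> = (\<lambda>j\<in>{0..m+1}.
     inv (unroll n \<beta> (cyclic_dual f 0)) \<otimes> unroll n \<beta> (cyclic_dual f (int j)))"

lemma push_in_seqs:
  assumes f: "f \<in> cyclic_maps n m" and \<beta>: "\<beta> \<in> seqs n"
  shows "push n m f \<beta> \<in> seqs m"
proof (rule seqsI)
  note c [simp] = unroll_closed[OF \<beta>]
  show "lo_le G P (push n m f \<beta> i) (push n m f \<beta> j)" if "i \<le> j" "j \<le> m + 1" for i j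
    using that unroll_mono[OF \<beta> cyclic_dual_mono[OF f, of "int i" "int j"]]
    by (simp add: push_def lo_le_mult_left)
  \<comment> \<open>One full period multiplies by \<open>z\<close> on the left; centrality moves
    \<open>z\<close> to the right, so that the inverse in \<open>push\<close> cancels the
    value.\<close>
  have "unroll n \<beta> (cyclic_dual f (int m + 1)) = z \<otimes> unroll n \<beta> (cyclic_dual f 0)"
    using cyclic_dual_shift[OF f, of 0 1] unroll_shift[OF \<beta>, of "cyclic_dual f 0" 1] by simp
  also have "\<dots> = unroll n \<beta> (cyclic_dual f 0) \<otimes> z" by (rule z_central) simp
  finally show "push n m f \<beta> (m + 1) = z"
    by (simp add: push_def add.commute flip: m_assoc)
qed (simp_all add: push_def unroll_closed[OF \<beta>])

text \<open>Extends the formula of \<open>push\<close> to all integers, so that a second map can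
  act. The factor \<open>z [^] k\<close> has to pass the inverse on the left, which centrality
  allows.\<close>

lemma unroll_push:
  assumes f: "f \<in> cyclic_maps n m" and \<beta>: "\<beta> \<in> seqs n"
  shows "unroll m (push n m f \<beta>) y
    = inv (unroll n \<beta> (cyclic_dual f 0)) \<otimes> unroll n \<beta> (cyclic_dual f y)"
proof -
  obtain r k where r: "r \<le> m" and y: "y = int r + k * (int m + 1)" by (rule int_decomp)
  have "unroll m (push n m f \<beta>) y = z [^] k \<otimes> push n m f \<beta> r"
    unfolding y using r by (intro unroll_eq[OF push_in_seqs[OF f \<beta>]]) simp
  also have "\<dots> = inv (unroll n \<beta> (cyclic_dual f 0)) \<otimes>
      (z [^] k \<otimes> unroll n \<beta> (cyclic_dual f (int r)))"
    using r by (simp add: push_def z_pow_comm3 unroll_closed[OF \<beta>])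
  also have "z [^] k \<otimes> unroll n \<beta> (cyclic_dual f (int r)) = unroll n \<beta> (cyclic_dual f y)"
    unfolding y cyclic_dual_shift[OF f] unroll_shift[OF \<beta>] by simp
  finally show ?thesis .
qed

lemma push_comp:
  assumes f: "f \<in> cyclic_maps n m" and g: "g \<in> cyclic_maps m l" and \<beta>: "\<beta> \<in> seqs n"
  shows "push m l g (push n m f \<beta>) = push n l (g \<circ> f) \<beta>"
proof
  \<comment> \<open>\<open>a\<close>, \<open>b\<close>, \<open>c\<close> are the values of the
    unrolled \<open>\<beta>\<close> at \<open>cyclic_dual f 0\<close>,
    \<open>cyclic_dual f (cyclic_dual g 0)\<close> and
    \<open>cyclic_dual f (cyclic_dual g (int j))\<close>; the divisor of the first step
    cancels.\<close>
  have "inv (inv a \<otimes> b) \<otimes> (inv a \<otimes> c) = inv b \<otimes> c"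
    if "a \<in> carrier G" "b \<in> carrier G" "c \<in> carrier G" for a b c
    using that by (simp add: inv_mult_group m_assoc)
  then show "push m l g (push n m f \<beta>) j = push n l (g \<circ> f) \<beta> j" for j
    unfolding push_def[of m] push_def[of n l] unroll_push[OF f \<beta>] cyclic_dual_comp[OF f g]
    by (simp add: unroll_closed[OF \<beta>] restrict_def)
qed

lemma push_id:
  assumes \<beta>: "\<beta> \<in> seqs n"
  shows "push n n (\<lambda>x. x) \<beta> = \<beta>"
proof
  have "cyclic_dual (\<lambda>x. x) y = y" for y using cyclic_dual_add[of 0] by simp
  moreover have "\<beta> \<in> extensional {0..n+1}" using \<beta> by (auto simp: interval_seqs_def PiE_iff)
  ultimately show "push n n (\<lambda>x. x) \<beta> j = \<beta> j" for j
    using unroll_of_nat[OF \<beta>, of j] unroll_of_nat[OF \<beta>, of 0] seqs_0[OF \<beta>] seqs_closed[OF \<beta>, of j]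
    by (auto simp: push_def extensional_def)
qed

lemma push_translate:
  assumes f: "f \<in> cyclic_maps n m" and \<beta>: "\<beta> \<in> seqs n"
  shows "push n m (\<lambda>x. f x + k * (int m + 1)) \<beta> = push n m f \<beta>"
proof -
  have d: "cyclic_dual (\<lambda>x. f x + k * (int m + 1)) y = cyclic_dual f y + (- k) * (int n + 1)" for y
    using cyclic_dual_translate[OF f, of "k * (int m + 1)" y] cyclic_dual_shift[OF f, of y "- k"]
    by simp
  have "inv (c \<otimes> a) \<otimes> (c \<otimes> b) = inv a \<otimes> b"
    if "a \<in> carrier G" "b \<in> carrier G" "c \<in> carrier G" for a b c
    using that by (simp add: inv_mult_group m_assoc)
  then show ?thesis
    unfolding push_def d unroll_shift[OF \<beta>] by (simp add: unroll_closed[OF \<beta>])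
qed

text \<open>The dual of a lift fixes 0, so the divisor is \<open>\<beta> 0 = \<one>\<close> and only
  the reindexing by \<open>dual_map\<close> remains.\<close>

lemma push_simplex:
  assumes f: "f \<in> cat_hom simplex_cat n m" and \<beta>: "\<beta> \<in> seqs n"
  shows "push n m (simplex_lift n m f) \<beta> = (\<lambda>j\<in>{0..m+1}. \<beta> (dual_map n f j))"
proof -
  have "cyclic_dual (simplex_lift n m f) 0 = 0"
    using cyclic_dual_simplex_lift[OF f, of 0] dual_map_0[OF f] by simp
  then have "unroll n \<beta> (cyclic_dual (simplex_lift n m f) 0) = \<one>"
    using unroll_of_nat[OF \<beta>, of 0] seqs_0[OF \<beta>] by simp
  then show ?thesis
    using dual_map_le[OF f] seqs_closed[OF \<beta>]
    by (auto simp: push_def cyclic_dual_simplex_lift[OF f] unroll_of_nat[OF \<beta>])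
qed

text \<open>Decrementing has incrementing as its dual, so the divisor is the entry at 1 and indices
  move up by one.\<close>

lemma push_rotation:
  assumes \<beta>: "\<beta> \<in> seqs n"
  shows "push n n (\<lambda>x. x - 1) \<beta>
    = (\<lambda>j\<in>{0..n+1}. if j \<le> n then inv (\<beta> 1) \<otimes> \<beta> (j + 1) else z)"
proof
  fix j
  have f: "(\<lambda>x. x - 1) \<in> cyclic_maps n n" by (rule rotation_cyclic_maps)
  have d: "cyclic_dual (\<lambda>x. x - 1) y = y + 1" for y using cyclic_dual_add[of "-1" y] by simp
  consider "j \<le> n" | "j = n + 1" | "j > n + 1" by linarith
  then show "push n n (\<lambda>x. x - 1) \<beta> j
    = (\<lambda>j\<in>{0..n+1}. if j \<le> n then inv (\<beta> 1) \<otimes> \<beta> (j + 1) else z) j"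
  proof cases
    case 1
    then show ?thesis
      using unroll_of_nat[OF \<beta>, of 1] unroll_of_nat[OF \<beta>, of "j + 1"]
      by (simp add: push_def d add.commute)
  next
    \<comment> \<open>The unrolled value would be taken at \<open>n + 2\<close>, past the range of
      \<open>unroll_of_nat\<close>; membership in \<open>seqs n\<close> gives the last entry
      directly.\<close>
    case 2
    then show ?thesis using seqs_top[OF push_in_seqs[OF f \<beta>]] by simp
  qed (simp add: push_def)
qed

section \<open>The functor on the cyclic category\<close>

text \<open>By \<open>push_translate\<close> the choice of the representative does not matter.\<close>

definition cyclic_point :: "(nat, (int \<Rightarrow> int) set, nat \<Rightarrow> 'a) set_diagram" where
  "cyclic_point = \<lparr>on_obj = seqs,
     on_arr = (\<lambda>n m. \<lambda>\<phi>\<in>cat_hom cyclic_cat n m. \<lambda>\<beta>\<in>seqs n. push n m (SOME f. f \<in> \<phi>) \<beta>)\<rparr>"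

lemma cyclic_point_class:
  assumes f: "f \<in> cyclic_maps n m"
  shows "on_arr cyclic_point n m (cyclic_class n m f) = (\<lambda>\<beta>\<in>seqs n. push n m f \<beta>)"
proof -
  have "\<exists>g. g \<in> cyclic_class n m f" using cyclic_class_eq[OF f] by auto
  then have "(SOME g. g \<in> cyclic_class n m f) \<in> cyclic_class n m f" by (rule someI_ex)
  then obtain k where "(SOME g. g \<in> cyclic_class n m f) = (\<lambda>x. f x + k * (int m + 1))"
    using cyclic_class_eq[OF f] by auto
  then show ?thesis
    using f by (auto simp: cyclic_point_def cyclic_class_hom push_translate)
qed

lemma set_functor_cyclic_point: "set_functor cyclic_cat cyclic_point"
  unfolding set_functor_def
proof (intro conjI allI ballI)
  have obj: "on_obj cyclic_point = seqs" by (simp add: cyclic_point_def)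
  fix n m
  show "on_arr cyclic_point n m
      \<in> cat_hom cyclic_cat n m \<rightarrow>\<^sub>E (on_obj cyclic_point n \<rightarrow>\<^sub>E on_obj cyclic_point m)"
  proof (rule PiE_I)
    fix \<phi> assume "\<phi> \<in> cat_hom cyclic_cat n m"
    then show "on_arr cyclic_point n m \<phi> \<in> on_obj cyclic_point n \<rightarrow>\<^sub>E on_obj cyclic_point m"
      by (rule cyclic_hom_cases) (auto simp: cyclic_point_class obj push_in_seqs)
  qed (simp add: cyclic_point_def)
  have "cat_id cyclic_cat n = cyclic_class n n (\<lambda>x. x)" by (simp add: cyclic_cat_def)
  then show "on_arr cyclic_point n n (cat_id cyclic_cat n) = (\<lambda>u\<in>on_obj cyclic_point n. u)"
    by (auto simp: cyclic_point_class cyclic_maps_id obj push_id)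
  fix l \<phi> \<psi> assume "\<phi> \<in> cat_hom cyclic_cat n m" "\<psi> \<in> cat_hom cyclic_cat m l"
  then obtain f g where f: "f \<in> cyclic_maps n m" "\<phi> = cyclic_class n m f"
    and g: "g \<in> cyclic_maps m l" "\<psi> = cyclic_class m l g"
    by (meson cyclic_hom_cases)
  show "on_arr cyclic_point n l (cat_comp cyclic_cat n m l \<psi> \<phi>)
    = compose (on_obj cyclic_point n) (on_arr cyclic_point m l \<psi>) (on_arr cyclic_point n m \<phi>)"
    unfolding f(2) g(2) cyclic_comp_class[OF f(1) g(1)] obj
    using f(1) g(1)
    by (auto simp: cyclic_point_class cyclic_maps_comp compose_def push_comp push_in_seqs)
qed

lemma cyclic_structure_cyclic_point:
  "cyclic_structure (lo_interval G P \<one> z) (lo_le G P) \<one> z cyclic_point"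
proof -
  have "(\<lambda>f\<in>cat_hom simplex_cat n m. on_arr cyclic_point n m (simplex_to_cyclic n m f))
    = (\<lambda>f\<in>cat_hom simplex_cat n m. \<lambda>\<beta>\<in>seqs n. \<lambda>j\<in>{0..m+1}. \<beta> (dual_map n f j))" for n m
    by (intro restrict_ext ext)
      (simp add: simplex_to_cyclic_def cyclic_point_class simplex_lift_cyclic push_simplex
        restrict_def)
  moreover have "on_obj cyclic_point = seqs" by (simp add: cyclic_point_def)
  ultimately show ?thesis
    unfolding cyclic_structure_def restrict_along_def interval_point_def
    using set_functor_cyclic_point by simp
qed

end

theorem proposition4p2:
  fixes G :: "('a, 'b) monoid_scheme" and P :: "'a set" and z :: 'a
  assumes "group G"
    and "left_order G P"
    and "z \<in> P"
    and "\<forall>g\<in>carrier G. z \<otimes>\<^bsub>G\<^esub> g = g \<otimes>\<^bsub>G\<^esub> z"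
    and "lo_less G P \<one>\<^bsub>G\<^esub> z"
  shows "\<exists>!T. cyclic_structure (lo_interval G P \<one>\<^bsub>G\<^esub> z) (lo_le G P) \<one>\<^bsub>G\<^esub> z T \<and>
    (\<forall>n. \<forall>\<beta>\<in>interval_seqs (lo_interval G P \<one>\<^bsub>G\<^esub> z) (lo_le G P) \<one>\<^bsub>G\<^esub> z n.
       on_arr T n n (tau n) \<beta> =
         (\<lambda>j\<in>{0..n+1}. if j \<le> n then inv\<^bsub>G\<^esub> (\<beta> 1) \<otimes>\<^bsub>G\<^esub> \<beta> (j + 1) else z))"
proof -
  interpret left_ordered_group_central G P z
    using assms by (simp add: left_ordered_group_central_def left_ordered_group_def
        left_ordered_group_axioms_def left_ordered_group_central_axioms_def)
  have "on_arr cyclic_point n n (tau n) \<beta>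
      = (\<lambda>j\<in>{0..n+1}. if j \<le> n then inv\<^bsub>G\<^esub> (\<beta> 1) \<otimes>\<^bsub>G\<^esub> \<beta> (j + 1) else z)"
    if "\<beta> \<in> seqs n" for n \<beta>
    using that by (simp only: tau_def cyclic_point_class[OF rotation_cyclic_maps] restrict_apply'
        push_rotation)
  \<comment> \<open>Any other candidate follows the same formula on every \<open>tau n\<close>,
    hence equals \<open>cyclic_point\<close> by \<open>cyclic_structure_unique\<close>.\<close>
  then show ?thesis
    using cyclic_structure_cyclic_point
    by (intro ex1I[of _ cyclic_point] conjI allI ballI cyclic_structure_unique) auto
qed

end
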